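(* Let $R=Q/P$ be a nonconstant rational function with $P,Q\in\mathbb{C}[z]$ coprime. Every bounded connected component of the affine inflection curve $\mathfrak{I}_R\subset\mathbb{C}$ contains at least one finite pole of $R$.
   Context: The affine inflection curve $\mathfrak{I}_R$ is the closure in $\mathbb{C}$ of $\{z\in\mathbb{C}: R(z)\neq0,\ P(z)\neq0,\ \operatorname{Im}R'(z)=0\}$; equivalently it is the zero set in $\mathbb{C}$ of $F_R=\frac{1}{2i}\bigl(W\overline{P}^{\,2}-\overline{W}P^2\bigr)$ with $W=Q'P-QP'$. In particular the finite poles of $R$ belong to $\mathfrak{I}_R$. *)

theory Defs
  imports "HOL-Complex_Analysis.Complex_Analysis"
    "HOL-Computational_Algebra.Computational_Algebra"
begin

(* Values at zeros of the denominator are junk (x / 0 = 0); every use below either excludes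
   those points or, as is_pole does, only looks at a punctured neighbourhood. *)
definition ratfun :: "complex poly \<Rightarrow> complex poly \<Rightarrow> complex \<Rightarrow> complex" where
  "ratfun Q P z = poly Q z / poly P z"

definition affine_inflection_curve :: "complex poly \<Rightarrow> complex poly \<Rightarrow> complex set" where
  "affine_inflection_curve Q P =
     closure {z. ratfun Q P z \<noteq> 0 \<and> poly P z \<noteq> 0 \<and> Im (deriv (ratfun Q P) z) = 0}"

end

theory Submission imports Defs begin

text \<open>
  Suppose that \<open>K\<close> contains no pole. Then \<open>K\<close> is compact, the derivative \<open>R'\<close> is holomorphic near
  \<open>K\<close> and real on \<open>K\<close>, so \<open>Re R'\<close> attains its maximum over \<open>K\<close> at some \<open>\<xi>\<close>. If \<open>R'\<close> is not
  constant, it is locally \<open>R' \<xi> + \<phi>\<^sup>n\<close> with \<open>\<phi>\<close> a conformal coordinate centred at \<open>\<xi>\<close>. The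
  preimage under \<open>\<phi>\<close> of a short segment \<open>[0, \<epsilon>]\<close> is an arc of the inflection curve through \<open>\<xi>\<close>,
  hence contained in \<open>K\<close>, on which \<open>R'\<close> takes real values larger than \<open>R' \<xi>\<close>: a contradiction.
  If \<open>R'\<close> is constant, the curve is empty or the whole plane.
\<close>

text \<open>\<open>n\<close> is the order of vanishing of \<open>f w - f \<xi>\<close> at
  \<open>\<xi>\<close>, finite because \<open>f\<close> is not constant on the connected set
  \<open>S\<close>. Near \<open>\<xi>\<close> the nonvanishing cofactor of
  \<open>(w - \<xi>) ^ n\<close> has a holomorphic nth root \<open>g\<close>, and
  \<open>\<phi> w = (w - \<xi>) * g w\<close> has derivative \<open>g \<xi> \<noteq> 0\<close> at
  \<open>\<xi>\<close>, so it is injective on a small disc.\<close>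

lemma holomorphic_nth_power_coordinate:
  assumes holf: "f holomorphic_on S" and S: "open S" "connected S" "\<xi> \<in> S"
    and nonconst: "\<not> f constant_on S"
  obtains \<phi> n r where "0 < n" "0 < r" "ball \<xi> r \<subseteq> S" "\<phi> holomorphic_on ball \<xi> r"
    "inj_on \<phi> (ball \<xi> r)" "\<phi> \<xi> = 0" "\<And>w. w \<in> ball \<xi> r \<Longrightarrow> f w = f \<xi> + \<phi> w ^ n"
proof -
  have ex: "\<exists>n>0. (deriv ^^ n) f \<xi> \<noteq> 0"
  proof (rule ccontr)
    assume "\<not> ?thesis"
    then have "f w = f \<xi>" if "w \<in> S" for w
      using holomorphic_fun_eq_const_on_connected[OF holf S(1,2) _ S(3) that] by blast
    then show False
      using nonconst unfolding constant_on_def by blast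
  qed
  define n where "n = (LEAST n. 0 < n \<and> (deriv ^^ n) f \<xi> \<noteq> 0)"
  have n: "0 < n" "(deriv ^^ n) f \<xi> \<noteq> 0"
    using LeastI_ex[OF ex] by (simp_all add: n_def)
  have min: "(deriv ^^ i) f \<xi> = 0" if "0 < i" "i < n" for i
    using not_less_Least[of i "\<lambda>n. 0 < n \<and> (deriv ^^ n) f \<xi> \<noteq> 0"] that by (simp add: n_def)
  obtain g r where r: "0 < r" and g: "g holomorphic_on ball \<xi> r"
    and eq: "\<And>w. w \<in> ball \<xi> r \<Longrightarrow> f w - f \<xi> = ((w - \<xi>) * g w) ^ n"
    and gnz: "\<And>w. w \<in> ball \<xi> r \<Longrightarrow> g w \<noteq> 0"
    by (rule holomorphic_factor_order_of_zero_strong[OF holf S(1,3) n min]) (assumption | blast)+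
  define \<phi> where "\<phi> = (\<lambda>w. (w - \<xi>) * g w)"
  have hol: "\<phi> holomorphic_on ball \<xi> r"
    unfolding \<phi>_def by (intro holomorphic_intros g)
  have "(g has_field_derivative deriv g \<xi>) (at \<xi>)"
    using g r by (intro holomorphic_derivI[OF g]) auto
  then have "(\<phi> has_field_derivative g \<xi>) (at \<xi>)"
    unfolding \<phi>_def by (auto intro!: derivative_eq_intros)
  then have "deriv \<phi> \<xi> \<noteq> 0"
    using gnz r by (simp add: DERIV_imp_deriv)
  moreover have "\<phi> holomorphic_on ball \<xi> r \<inter> S"
    using hol holomorphic_on_subset by blast
  moreover have "\<xi> \<in> ball \<xi> r \<inter> S" "open (ball \<xi> r \<inter> S)"
    using S r by auto
  ultimately obtain s where s: "s > 0" "ball \<xi> s \<subseteq> ball \<xi> r \<inter> S" "inj_on \<phi> (ball \<xi> s)"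
    using has_complex_derivative_locally_injective by metis
  show thesis
  proof (rule that[of n s \<phi>])
    show "\<phi> holomorphic_on ball \<xi> s"
      using hol s holomorphic_on_subset by blast
    show "f w = f \<xi> + \<phi> w ^ n" if "w \<in> ball \<xi> s" for w
      using eq[of w] that s(2) by (auto simp: \<phi>_def algebra_simps)
  qed (use n s in \<open>auto simp: \<phi>_def\<close>)
qed

text \<open>Connectedness of \<open>A\<close> suffices because \<open>A\<close> will be compared
  with a connected component. Together with \<open>\<xi> \<in> A\<close>, the condition
  \<open>A \<noteq> {\<xi>}\<close> supplies a point where the real part of \<open>f\<close> is
  strictly larger than at \<open>\<xi>\<close>.\<close>

lemma holomorphic_increasing_arc:
  assumes "f holomorphic_on S" "open S" "connected S" "\<xi> \<in> S" "\<not> f constant_on S"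
  obtains A where "connected A" "\<xi> \<in> A" "A \<subseteq> S" "A \<noteq> {\<xi>}"
    "\<And>w. w \<in> A \<Longrightarrow> w \<noteq> \<xi> \<Longrightarrow> \<exists>t>0. f w = f \<xi> + of_real t"
proof -
  obtain \<phi> n r where n: "0 < n" and r: "0 < r" "ball \<xi> r \<subseteq> S" and hol: "\<phi> holomorphic_on ball \<xi> r"
    and inj: "inj_on \<phi> (ball \<xi> r)" and \<phi>0: "\<phi> \<xi> = 0"
    and eq: "\<And>w. w \<in> ball \<xi> r \<Longrightarrow> f w = f \<xi> + \<phi> w ^ n"
    using holomorphic_nth_power_coordinate[OF assms] by metis
  obtain \<psi> where \<psi>: "\<psi> holomorphic_on \<phi> ` ball \<xi> r" "\<And>z. z \<in> ball \<xi> r \<Longrightarrow> \<psi> (\<phi> z) = z"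
    using holomorphic_has_inverse[OF hol open_ball inj] by metis
  have "open (\<phi> ` ball \<xi> r)"
    by (rule open_mapping_thm3[OF hol open_ball inj])
  moreover have "0 \<in> \<phi> ` ball \<xi> r"
    using \<phi>0 r by (metis centre_in_ball imageI)
  ultimately obtain e where e: "e > 0" "cball 0 e \<subseteq> \<phi> ` ball \<xi> r"
    using open_contains_cball by blast
  \<comment> \<open>The nth power maps this real segment into the nonnegative reals, so
    \<open>f w - f \<xi>\<close> is real and nonnegative on its preimage under
    \<open>\<phi>\<close>.\<close>
  define I where "I = complex_of_real ` {0..e}"
  have I: "I \<subseteq> \<phi> ` ball \<xi> r"
    using e by (force simp: I_def)
  have \<psi>I: "\<psi> z \<in> ball \<xi> r" "\<phi> (\<psi> z) = z" if "z \<in> I" for z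
    using that I \<psi>(2) by auto
  show thesis
  proof (rule that[of "\<psi> ` I"])
    have "connected I"
      unfolding I_def by (intro connected_continuous_image continuous_intros connected_Icc)
    moreover have "continuous_on I \<psi>"
      using \<psi>(1) I holomorphic_on_imp_continuous_on continuous_on_subset by blast
    ultimately show "connected (\<psi> ` I)"
      by (rule connected_continuous_image[rotated])
    have 0: "\<psi> 0 = \<xi>"
      using \<psi>(2)[of \<xi>] \<phi>0 r by simp
    have "0 \<in> I" "complex_of_real e \<in> I"
      using e by (auto simp: I_def image_iff intro: bexI[of _ 0])
    then show "\<xi> \<in> \<psi> ` I"
      using 0 by blast
    have "\<psi> (of_real e) \<noteq> \<xi>"
      using \<psi>I(2)[OF \<open>of_real e \<in> I\<close>] \<phi>0 e by auto
    then show "\<psi> ` I \<noteq> {\<xi>}"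
      using \<open>of_real e \<in> I\<close> by blast
    show "\<psi> ` I \<subseteq> S"
      using \<psi>I r by blast
    show "\<exists>t>0. f w = f \<xi> + of_real t" if w: "w \<in> \<psi> ` I" "w \<noteq> \<xi>" for w
    proof -
      obtain t where t: "t \<in> {0..e}" "w = \<psi> (of_real t)" "complex_of_real t \<in> I"
        using w(1) by (auto simp: I_def)
      then have "t > 0"
        using w(2) 0 by (cases "t = 0") auto
      moreover have "f w = f \<xi> + of_real (t ^ n)"
        using eq[of w] \<psi>I[OF t(3)] t(2) by simp
      ultimately show ?thesis
        by (intro exI[of _ "t ^ n"]) simp
    qed
  qed
qed

lemma ratfun_holomorphic_on: "ratfun Q P holomorphic_on {z. poly P z \<noteq> 0}"
  unfolding ratfun_def by (intro holomorphic_intros) auto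

lemma open_poly_nonzero: "open {z. poly P z \<noteq> (0 :: complex)}"
  by (intro open_Collect_neq continuous_on_poly continuous_on_id continuous_on_const)

text \<open>Coprimality keeps the numerator nonzero at \<open>p\<close>, and zeros of
  \<open>P\<close> are isolated, so \<open>P\<close> tends to 0 at \<open>p\<close> through nonzero
  values. Contrapositively, a component without poles avoids all zeros of \<open>P\<close>.\<close>

lemma is_pole_ratfun:
  assumes "coprime P Q" "P \<noteq> 0" "poly P p = 0"
  shows "is_pole (ratfun Q P) p"
  unfolding ratfun_def
proof (rule is_pole_divide)
  show "poly Q p \<noteq> 0"
    using coprime_poly_0[OF assms(1), of p] assms(3) by blast
  have "\<not> p islimpt {z. poly P z = 0}"
    by (intro islimpt_finite poly_roots_finite assms)
  then have "\<forall>\<^sub>F z in at p. poly P z \<noteq> 0"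
    by (simp add: islimpt_iff_eventually)
  moreover have "poly P \<midarrow>p\<rightarrow> 0"
    using isContD[OF poly_isCont[of p P]] assms(3) by simp
  ultimately show "filterlim (poly P) (at 0) (at p)"
    by (simp add: filterlim_at)
qed simp

text \<open>The closure may add points, such as zeros of \<open>R\<close>, that are outside the
  defining set; continuity of \<open>R'\<close> off the zeros of \<open>P\<close> carries the
  equation over to them.\<close>

lemma Im_deriv_ratfun_on_curve:
  assumes "z \<in> affine_inflection_curve Q P" "poly P z \<noteq> 0"
  shows "Im (deriv (ratfun Q P) z) = 0"
proof -
  define U where "U = {z. poly P z \<noteq> 0}"
  \<comment> \<open>Without the requirement \<open>R \<noteq> 0\<close> the set is relatively closed
    in \<open>U\<close>, hence the trace on \<open>U\<close> of a closed set \<open>D\<close>, and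
    \<open>D\<close> contains the whole curve.\<close>
  define X where "X = {z \<in> U. Im (deriv (ratfun Q P) z) = 0}"
  have "deriv (ratfun Q P) holomorphic_on U"
    unfolding U_def by (intro holomorphic_deriv ratfun_holomorphic_on open_poly_nonzero)
  then have "continuous_on U (\<lambda>z. Im (deriv (ratfun Q P) z))"
    by (intro continuous_intros holomorphic_on_imp_continuous_on)
  then have "closedin (top_of_set U) X"
    unfolding X_def by (rule continuous_closedin_preimage_constant)
  then obtain D where D: "closed D" "X = U \<inter> D"
    by (auto simp: closedin_closed)
  have "affine_inflection_curve Q P \<subseteq> D"
    unfolding affine_inflection_curve_def
    by (rule closure_minimal) (use D in \<open>auto simp: X_def U_def\<close>)
  then show ?thesis
    using D assms by (auto simp: X_def U_def)
qed

lemma connected_Compl_finite: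
  fixes F :: "complex set"
  assumes "finite F"
  shows "connected (- F)"
  unfolding Compl_eq_Diff_UNIV
  using assms by (intro connected_open_diff_countable) (simp_all add: countable_finite connected_UNIV)

text \<open>The complement of the finite zero set of \<open>P * Q\<close> is dense and lies in the
  set whose closure is the curve, because \<open>c\<close> is real.\<close>

lemma affine_inflection_curve_eq_UNIV:
  assumes "P \<noteq> 0" "Q \<noteq> 0"
    and const: "\<And>z. poly P z \<noteq> 0 \<Longrightarrow> poly Q z \<noteq> 0 \<Longrightarrow> deriv (ratfun Q P) z = of_real c"
  shows "affine_inflection_curve Q P = UNIV"
proof -
  have "finite {z. poly (P * Q) z = 0}"
    using assms by (intro poly_roots_finite) simp
  then have "closure (- {z. poly (P * Q) z = 0}) = UNIV"
    by (simp add: closure_complement empty_interior_finite)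
  moreover have "closure (- {z. poly (P * Q) z = 0})
      \<subseteq> closure {z. ratfun Q P z \<noteq> 0 \<and> poly P z \<noteq> 0 \<and> Im (deriv (ratfun Q P) z) = 0}"
    using const by (intro closure_mono) (auto simp: ratfun_def)
  ultimately show ?thesis
    unfolding affine_inflection_curve_def by (simp add: top.extremum_unique)
qed

theorem proposition5p4:
  fixes P Q :: "complex poly" and K :: "complex set"
  assumes "P \<noteq> 0"
    and "coprime P Q"
    and "\<not> ratfun Q P constant_on {z. poly P z \<noteq> 0}"
    and "K \<in> components (affine_inflection_curve Q P)"
    and "bounded K"
  shows "\<exists>p\<in>K. is_pole (ratfun Q P) p"
proof (rule ccontr)
  assume no_pole: "\<not> (\<exists>p\<in>K. is_pole (ratfun Q P) p)"
  define f where "f = deriv (ratfun Q P)"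
  define U where "U = {z. poly P z \<noteq> 0}"
  have Q: "Q \<noteq> 0"
    using assms(3) by (auto simp: ratfun_def constant_on_def)
  have KU: "K \<subseteq> U"
    using no_pole is_pole_ratfun[OF assms(2,1)] by (auto simp: U_def)
  have KI: "K \<subseteq> affine_inflection_curve Q P" and K0: "K \<noteq> {}"
    using assms(4) in_components_subset in_components_nonempty by blast+
  have real: "Im (f z) = 0" if "z \<in> K" for z
    using Im_deriv_ratfun_on_curve[of z Q P] that KI KU by (auto simp: f_def U_def)
  have holf: "f holomorphic_on U"
    unfolding f_def U_def by (intro holomorphic_deriv ratfun_holomorphic_on open_poly_nonzero)
  have "closed K"
    using assms(4) by (rule closed_components[rotated]) (simp add: affine_inflection_curve_def)
  then have "compact K"
    using assms(5) by (simp add: compact_eq_bounded_closed)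
  moreover have "continuous_on K (\<lambda>z. Re (f z))"
    by (intro continuous_on_Re holomorphic_on_imp_continuous_on holomorphic_on_subset[OF holf KU])
  ultimately obtain \<xi> where \<xi>: "\<xi> \<in> K" and max: "\<And>z. z \<in> K \<Longrightarrow> Re (f z) \<le> Re (f \<xi>)"
    using continuous_attains_sup[OF _ K0] by blast
  \<comment> \<open>Zeros of \<open>R\<close> other than \<open>\<xi>\<close> are removed so that the arc below meets the curve's defining
    condition \<open>R \<noteq> 0\<close> away from \<open>\<xi>\<close>.\<close>
  define F where "F = {z. poly (P * Q) z = 0} - {\<xi>}"
  have F: "finite F"
    unfolding F_def using poly_roots_finite[of "P * Q"] assms(1) Q by simp
  \<comment> \<open>As a point of \<open>K\<close>, \<open>\<xi>\<close> is not a zero of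
    \<open>P\<close>; leaving it out of \<open>F\<close> spares at most a zero of
    \<open>Q\<close>.\<close>
  have FU: "- F \<subseteq> U"
    using \<xi> KU by (auto simp: F_def U_def)
  show False
  proof (cases "f constant_on - F")
    case True
    then obtain c where c: "\<And>z. z \<in> - F \<Longrightarrow> f z = c"
      by (auto simp: constant_on_def)
    have "f z = of_real (Re (f \<xi>))" if "poly P z \<noteq> 0" "poly Q z \<noteq> 0" for z
    proof -
      \<comment> \<open>Since \<open>\<xi>\<close> itself lies in \<open>- F\<close>, the constant
        is the value at \<open>\<xi>\<close>, which is real because
        \<open>\<xi> \<in> K\<close>.\<close>
      have "f z = f \<xi>"
        using c[of z] c[of \<xi>] that by (simp add: F_def)
      then show ?thesis
        using real[OF \<xi>] by (simp add: complex_eq_iff)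
    qed
    then have "affine_inflection_curve Q P = UNIV"
      using affine_inflection_curve_eq_UNIV[OF assms(1) Q] by (auto simp: f_def)
    then have "K = UNIV"
      using components_maximal[OF assms(4) connected_UNIV] K0 by auto
    then show False
      using assms(5) not_bounded_UNIV by blast
  next
    case False
    have "f holomorphic_on - F"
      using holf FU by (rule holomorphic_on_subset)
    moreover have "open (- F)" "connected (- F)"
      using F by (auto intro: finite_imp_closed connected_Compl_finite)
    moreover have "\<xi> \<in> - F"
      by (simp add: F_def)
    ultimately obtain A where A: "connected A" "\<xi> \<in> A" "A \<subseteq> - F" "A \<noteq> {\<xi>}"
      and inc: "\<And>w. w \<in> A \<Longrightarrow> w \<noteq> \<xi> \<Longrightarrow> \<exists>t>0. f w = f \<xi> + of_real t"
      using holomorphic_increasing_arc[OF _ _ _ _ False] by metis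
    have "w \<in> affine_inflection_curve Q P" if w: "w \<in> A" "w \<noteq> \<xi>" for w
      unfolding affine_inflection_curve_def
    proof (rule subsetD[OF closure_subset], intro CollectI conjI)
      show "poly P w \<noteq> 0" "ratfun Q P w \<noteq> 0"
        using A(3) w by (auto simp: F_def ratfun_def)
      show "Im (deriv (ratfun Q P) w) = 0"
        using inc[OF w] real[OF \<xi>] by (auto simp: f_def)
    qed
    \<comment> \<open>The point \<open>\<xi>\<close> may be a zero of \<open>R\<close>; it is on the
      curve as a point of \<open>K\<close>.\<close>
    then have "A \<subseteq> affine_inflection_curve Q P"
      using \<xi> KI by blast
    then have "A \<subseteq> K"
      using components_maximal[OF assms(4) A(1)] A(2) \<xi> by blast
    moreover obtain w where w: "w \<in> A" "w \<noteq> \<xi>"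
      using A(2,4) by blast
    ultimately show False
      using max[of w] inc[OF w] by auto
  qed
qed

end
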